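(* Let $X=[0,1]$, let $A=C(X,\mathbb K)$, let $\{t_i\}_{i\in\mathbb N}$ be a countable dense subset of $X$, and let $J=\{x\in A: fx\in A\}$, where $f:X\to\mathbb K$ is given by $f(t)=\sum_{i\in\mathbb N}\frac{1}{2^i}\chi_{[0,t_i]}(t)p_i$. Let $(\eta_i)_{i\in\mathbb N}$ be scalars with $\eta_i\neq 0$ for every $i\in\mathbb N$ and $\sum_{i=1}^\infty|\eta_i|^2<1/2$. Let $b\in\mathbb K$ be the operator whose matrix $(b_{ij})_{i,j=1}^\infty$ in the basis $\{e_i\}$ is given by $b_{i1}=\eta_i$ and $b_{ij}=0$ for $j>1$, and let $c=b+1\in C(X,\mathbb B(H))$ (a constant, invertible function). Set $I=c^{-1}J=\{c^{-1}x:x\in J\}$, a closed right ideal of $A$. Then the ideal $I\cap J\subset A$ is not thick.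
   Context: $H$ is a separable infinite-dimensional Hilbert space with a fixed orthonormal basis $\{e_i\}_{i\in\mathbb N}$ ($\mathbb N=\{1,2,\dots\}$), $\mathbb K$ and $\mathbb B(H)$ are the $C^*$-algebras of compact and of bounded operators on $H$, and $C(X,\mathbb K)$, $C(X,\mathbb B(H))$ are the $C^*$-algebras of norm-continuous functions on $X$ with values in $\mathbb K$, resp. $\mathbb B(H)$, with pointwise operations. The matrix of an operator $x$ is $x_{ij}=(e_i,xe_j)$. $p_i$ is the rank one projection onto the span of $e_i$, and $\chi_E$ is the characteristic function of $E\subset X$. The product $fx$ is the pointwise product; so $J$ consists of those $x\in A$ for which the function $fx$ is continuous, and it is a closed right ideal in $A$. A closed right ideal $L$ of a $C^*$-algebra $A$ is called thick if, for $a\in A$, $aL=0$ (i.e. $ax=0$ for all $x\in L$) implies $a=0$. *)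

theory Defs
  imports "HOL-Analysis.Analysis"
begin

text \<open>The norm (and hence the topology) is the one induced by the inner product, which is linear in
  its second argument.  Completeness comes from the superclass \<^class>\<open>banach\<close>.\<close>

class complex_hilbert = banach +
  fixes scaleC :: "complex \<Rightarrow> 'a \<Rightarrow> 'a" (infixr "*\<^sub>C" 75)
    and cinner :: "'a \<Rightarrow> 'a \<Rightarrow> complex"
  assumes scaleC_add_right: "a *\<^sub>C (x + y) = a *\<^sub>C x + a *\<^sub>C y"
    and scaleC_add_left: "(a + b) *\<^sub>C x = a *\<^sub>C x + b *\<^sub>C x"
    and scaleC_scaleC: "a *\<^sub>C (b *\<^sub>C x) = (a * b) *\<^sub>C x"
    and scaleR_scaleC: "r *\<^sub>R x = complex_of_real r *\<^sub>C x"
    and cinner_commute: "cinner x y = cnj (cinner y x)"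
    and cinner_add_right: "cinner x (y + z) = cinner x y + cinner x z"
    and cinner_scaleC_right: "cinner x (a *\<^sub>C y) = a * cinner x y"
    and cinner_self: "cinner x x = complex_of_real ((norm x)\<^sup>2)"

global_interpretation complex_vector:
  vector_space "scaleC :: complex \<Rightarrow> 'a \<Rightarrow> 'a::complex_hilbert"
proof
  show "1 *\<^sub>C x = x" for x :: 'a
    using scaleR_scaleC[of 1 x] by simp
qed (simp_all add: scaleC_add_right scaleC_add_left scaleC_scaleC)

lemma cinner_add_left: "cinner (x + y) z = cinner x z + cinner y (z :: 'h::complex_hilbert)"
  by (metis cinner_commute cinner_add_right complex_cnj_add)

lemma cinner_scaleC_left: "cinner (a *\<^sub>C x) y = cnj a * cinner x (y :: 'h::complex_hilbert)"
  by (metis cinner_commute cinner_scaleC_right complex_cnj_mult)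

lemma norm_scaleC: "norm (a *\<^sub>C x) = cmod a * norm (x :: 'h::complex_hilbert)"
proof -
  have "complex_of_real ((norm (a *\<^sub>C x))\<^sup>2) = (a * cnj a) * cinner x x"
    by (simp only: cinner_self[symmetric] cinner_scaleC_left cinner_scaleC_right mult_ac)
  also have "\<dots> = complex_of_real ((cmod a * norm x)\<^sup>2)"
    unfolding complex_norm_square[symmetric] cinner_self by (simp add: power_mult_distrib)
  finally have "(norm (a *\<^sub>C x))\<^sup>2 = (cmod a * norm x)\<^sup>2"
    using of_real_eq_iff by blast
  then show ?thesis
    by (simp add: power2_eq_iff_nonneg)
qed

lemma cinner_zero_left: "cinner 0 (y :: 'h::complex_hilbert) = 0"
  using cinner_add_left[of 0 0 y] by simp

lemma cinner_bound: "cmod (cinner x y) \<le> norm x * norm (y :: 'h::complex_hilbert)"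
proof (cases "x = 0")
  case True
  then show ?thesis by (simp add: cinner_zero_left)
next
  case False
  define n where "n = (norm x)\<^sup>2"
  define k where "k = cinner x y"
  have n: "n > 0" using False by (simp add: n_def)
  let ?w = "complex_of_real n *\<^sub>C y + (- k) *\<^sub>C x"
  have yx: "cinner y x = cnj k"
    unfolding k_def by (rule cinner_commute)
  have "complex_of_real ((norm ?w)\<^sup>2) = cinner ?w ?w"
    by (rule cinner_self[symmetric])
  also have "\<dots> = complex_of_real n * (complex_of_real n * cinner y y - k * cnj k)"
    unfolding cinner_add_left cinner_add_right cinner_scaleC_left cinner_scaleC_right yx
    by (simp add: k_def[symmetric] cinner_self[of x] n_def[symmetric] algebra_simps)
  also have "\<dots> = complex_of_real (n * (n * (norm y)\<^sup>2 - (cmod k)\<^sup>2))"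
    unfolding complex_norm_square[symmetric] cinner_self by simp
  finally have "(norm ?w)\<^sup>2 = n * (n * (norm y)\<^sup>2 - (cmod k)\<^sup>2)"
    using of_real_eq_iff by blast
  then have "0 \<le> n * (n * (norm y)\<^sup>2 - (cmod k)\<^sup>2)"
    by (metis zero_le_power2)
  with n have "(cmod k)\<^sup>2 \<le> (norm x * norm y)\<^sup>2"
    by (simp add: zero_le_mult_iff n_def power_mult_distrib)
  then show ?thesis
    unfolding k_def by (rule power2_le_imp_le) simp
qed

definition orthonormal_basis :: "'i set \<Rightarrow> ('i \<Rightarrow> 'h::complex_hilbert) \<Rightarrow> bool" where
  "orthonormal_basis N e \<longleftrightarrow>
     (\<forall>i\<in>N. \<forall>j\<in>N. cinner (e i) (e j) = (if i = j then 1 else 0)) \<and>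
     closure (complex_vector.span (e ` N)) = UNIV"

text \<open>The type \<open>'h \<Rightarrow>\<^sub>L 'h\<close> consists of the real-linear bounded operators with the operator norm;
  the elements of $B(H)$ are the complex-linear ones among them.\<close>

definition bounded_ops :: "('h::complex_hilbert \<Rightarrow>\<^sub>L 'h) set" where
  "bounded_ops = {T. \<forall>a v. blinfun_apply T (a *\<^sub>C v) = a *\<^sub>C blinfun_apply T v}"

definition compact_ops :: "('h::complex_hilbert \<Rightarrow>\<^sub>L 'h) set" where
  "compact_ops = {T \<in> bounded_ops. compact (closure (blinfun_apply T ` cball 0 1))}"

lift_definition scaleC_op :: "complex \<Rightarrow> ('h::complex_hilbert \<Rightarrow>\<^sub>L 'h) \<Rightarrow> ('h \<Rightarrow>\<^sub>L 'h)"
  is "\<lambda>a T v. a *\<^sub>C T v"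
proof -
  fix a :: complex and T :: "'h \<Rightarrow> 'h"
  assume "bounded_linear T"
  then interpret T: bounded_linear T .
  obtain K where K: "\<And>v. norm (T v) \<le> norm v * K"
    using T.bounded by blast
  show "bounded_linear (\<lambda>v. a *\<^sub>C T v)"
  proof (rule bounded_linear_intro)
    show "norm (a *\<^sub>C T v) \<le> norm v * (cmod a * K)" for v
      using mult_left_mono[OF K[of v], of "cmod a"] by (simp add: norm_scaleC mult_ac)
    show "a *\<^sub>C T (r *\<^sub>R v) = r *\<^sub>R (a *\<^sub>C T v)" for r v
      unfolding T.scaleR by (simp add: scaleR_scaleC scaleC_scaleC mult_ac)
  qed (simp add: T.add scaleC_add_right)
qed

text \<open>For a unit vector \<open>u\<close> this is the orthogonal projection onto the span of \<open>u\<close>.\<close>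

lift_definition rank_one_proj :: "'h::complex_hilbert \<Rightarrow> ('h \<Rightarrow>\<^sub>L 'h)"
  is "\<lambda>u v. cinner u v *\<^sub>C u"
proof -
  fix u :: 'h
  show "bounded_linear (\<lambda>v. cinner u v *\<^sub>C u)"
  proof (rule bounded_linear_intro)
    show "norm (cinner u v *\<^sub>C u) \<le> norm v * (norm u * norm u)" for v
      using mult_right_mono[OF cinner_bound[of u v], of "norm u"] by (simp add: norm_scaleC mult_ac)
  qed (simp_all add: cinner_add_right cinner_scaleC_right scaleC_add_left scaleR_scaleC scaleC_scaleC)
qed

definition op_matrix :: "('i \<Rightarrow> 'h::complex_hilbert) \<Rightarrow> ('h \<Rightarrow>\<^sub>L 'h) \<Rightarrow> 'i \<Rightarrow> 'i \<Rightarrow> complex" where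
  "op_matrix e T i j = cinner (e i) (blinfun_apply T (e j))"

text \<open>Functions on \<open>X\<close> are represented by functions that are \<^const>\<open>undefined\<close> outside \<open>X\<close>, so that
  equality of representatives is equality on \<open>X\<close>.\<close>

definition cont_fun :: "'x::topological_space set \<Rightarrow> ('h::complex_hilbert \<Rightarrow>\<^sub>L 'h) set
    \<Rightarrow> ('x \<Rightarrow> ('h \<Rightarrow>\<^sub>L 'h)) set" where
  "cont_fun X S = {x \<in> X \<rightarrow>\<^sub>E S. continuous_on X x}"

definition fun_mult :: "'x set \<Rightarrow> ('x \<Rightarrow> ('h::complex_hilbert \<Rightarrow>\<^sub>L 'h))
    \<Rightarrow> ('x \<Rightarrow> ('h \<Rightarrow>\<^sub>L 'h)) \<Rightarrow> ('x \<Rightarrow> ('h \<Rightarrow>\<^sub>L 'h))" where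
  "fun_mult X x y = (\<lambda>s\<in>X. x s o\<^sub>L y s)"

definition is_fun_inverse :: "'x::topological_space set \<Rightarrow> ('x \<Rightarrow> ('h::complex_hilbert \<Rightarrow>\<^sub>L 'h))
    \<Rightarrow> ('x \<Rightarrow> ('h \<Rightarrow>\<^sub>L 'h)) \<Rightarrow> bool" where
  "is_fun_inverse X c d \<longleftrightarrow>
     c \<in> cont_fun X bounded_ops \<and> d \<in> cont_fun X bounded_ops \<and>
     fun_mult X c d = (\<lambda>s\<in>X. id_blinfun) \<and> fun_mult X d c = (\<lambda>s\<in>X. id_blinfun)"

definition fun_inverse :: "'x::topological_space set \<Rightarrow> ('x \<Rightarrow> ('h::complex_hilbert \<Rightarrow>\<^sub>L 'h))
    \<Rightarrow> ('x \<Rightarrow> ('h \<Rightarrow>\<^sub>L 'h))" where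
  "fun_inverse X c = (THE d. is_fun_inverse X c d)"

text \<open>Here \<open>A\<close> is an algebra of functions on \<open>X\<close>.  For compact \<open>X\<close>, closedness under uniform limits
  on \<open>X\<close> is closedness in the supremum norm.\<close>

definition closed_right_ideal :: "'x::topological_space set \<Rightarrow> ('x \<Rightarrow> ('h::complex_hilbert \<Rightarrow>\<^sub>L 'h)) set
    \<Rightarrow> ('x \<Rightarrow> ('h \<Rightarrow>\<^sub>L 'h)) set \<Rightarrow> bool" where
  "closed_right_ideal X A L \<longleftrightarrow>
     L \<subseteq> A \<and>
     (\<lambda>s\<in>X. 0) \<in> L \<and>
     (\<forall>x\<in>L. \<forall>y\<in>L. (\<lambda>s\<in>X. x s + y s) \<in> L) \<and>
     (\<forall>k. \<forall>x\<in>L. (\<lambda>s\<in>X. scaleC_op k (x s)) \<in> L) \<and>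
     (\<forall>x\<in>L. \<forall>a\<in>A. fun_mult X x a \<in> L) \<and>
     (\<forall>xs x. (\<forall>n::nat. xs n \<in> L) \<longrightarrow> x \<in> A \<longrightarrow> uniform_limit X xs x sequentially \<longrightarrow> x \<in> L)"

definition thick :: "'x set \<Rightarrow> ('x \<Rightarrow> ('h::complex_hilbert \<Rightarrow>\<^sub>L 'h)) set
    \<Rightarrow> ('x \<Rightarrow> ('h \<Rightarrow>\<^sub>L 'h)) set \<Rightarrow> bool" where
  "thick X A L \<longleftrightarrow>
     (\<forall>a\<in>A. (\<forall>x\<in>L. fun_mult X a x = (\<lambda>s\<in>X. 0)) \<longrightarrow> a = (\<lambda>s\<in>X. 0))"

end

theory Submission
  imports Defs
begin

text \<open>
  Write \<open>\<langle>u, v\<rangle>\<close> for \<^term>\<open>cinner u v\<close>.  Multiplying by \<open>f\<close> scales the \<open>i\<close>-th row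
  \<open>\<langle>e\<^sub>i, x(s) v\<rangle>\<close> of a function \<open>x\<close> by \<open>2\<^sup>-\<^sup>i\<close> up to the point \<open>t\<^sub>i\<close> and kills it
  afterwards.  So if \<open>f x\<close> is continuous and \<open>t\<^sub>i < 1\<close>, then the \<open>i\<close>-th row of \<open>x\<close> must vanish at
  \<open>t\<^sub>i\<close> (lemma \<open>vanishes_at_cutoff\<close>).

  Now let \<open>x\<close> lie in \<open>J\<close> and in \<open>I = c\<^sup>-\<^sup>1 J\<close>.  If \<open>t\<^sub>i < 1\<close>, then the \<open>i\<close>-th rows of
  both \<open>x\<close> and \<open>c x = x + b x\<close> vanish at \<open>t\<^sub>i\<close>, hence so does that of \<open>b x\<close>.  The matrix of \<open>b\<close> is supported in its first
  column, so the \<open>i\<close>-th row of \<open>b x\<close> is \<open>\<eta>\<^sub>i\<close> times the first row of \<open>x\<close>.  As \<open>\<eta>\<^sub>i \<noteq> 0\<close>, the first row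
  of \<open>x\<close> vanishes at every \<open>t\<^sub>i < 1\<close>.  These points are dense, so the first row of \<open>x\<close> is zero
  (lemma \<open>zero_on_unit_interval\<close>).  Therefore the constant function with value the projection onto
  the span of \<open>e\<^sub>1\<close>, a nonzero element of \<open>A\<close>, annihilates \<open>I \<inter> J\<close> from the left.

  That the sets in question are closed right ideals follows for \<open>J\<close> because \<open>f\<close> is bounded with
  complex-linear values (lemma \<open>closed_right_ideal_multiplier\<close>) and for \<open>I\<close> because \<open>c\<close>
  is invertible (lemma \<open>closed_right_ideal_inverse_image\<close>).  For the latter, the first-column shape gives
  \<open>b\<^sup>2 = \<eta>\<^sub>1 b\<close>, so \<open>1 - (1 + \<eta>\<^sub>1)\<^sup>-\<^sup>1 b\<close> inverts \<open>1 + b\<close>; the bound on \<open>\<Sum>\<bar>\<eta>\<^sub>i\<bar>\<^sup>2\<close> guarantees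
  \<open>1 + \<eta>\<^sub>1 \<noteq> 0\<close>.
\<close>

section \<open>Inner product and orthonormal bases\<close>

lemma bounded_linear_cinner: "bounded_linear (cinner (u :: 'h::complex_hilbert))"
proof (rule bounded_linear_intro)
  show "norm (cinner u v) \<le> norm v * norm u" for v
    using cinner_bound[of u v] by (simp add: mult.commute)
qed (simp_all add: cinner_add_right cinner_scaleC_right scaleR_scaleC scaleR_conv_of_real)

lemma bounded_linear_scaleC: "bounded_linear (\<lambda>v :: 'h::complex_hilbert. k *\<^sub>C v)"
proof (rule bounded_linear_intro)
  show "norm (k *\<^sub>C v) \<le> norm v * cmod k" for v :: 'h
    by (simp add: norm_scaleC mult.commute)
qed (simp_all add: scaleC_add_right scaleR_scaleC scaleC_scaleC mult.commute)

lemma bounded_linear_scaleC_left: "bounded_linear (\<lambda>k. k *\<^sub>C (v :: 'h::complex_hilbert))"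
proof (rule bounded_linear_intro)
  show "norm (k *\<^sub>C v) \<le> norm k * norm v" for k
    by (simp add: norm_scaleC)
qed (simp_all add: scaleC_add_left scaleR_scaleC scaleC_scaleC scaleR_conv_of_real)

lemma scaleC_one: "1 *\<^sub>C (v :: 'h::complex_hilbert) = v"
  by (rule complex_vector.vector_space_assms(4))

text \<open>Both functionals are continuous, and the linear span of an orthonormal basis is dense.\<close>

lemma orthonormal_basis_eqI:
  fixes e :: "'i \<Rightarrow> 'h::complex_hilbert"
  assumes "orthonormal_basis N e" "bounded_linear F" "bounded_linear G"
    and F: "\<And>k v. F (k *\<^sub>C v) = k * F v" and G: "\<And>k v. G (k *\<^sub>C v) = k * G v"
    and eq: "\<And>i. i \<in> N \<Longrightarrow> F (e i) = G (e i)"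
  shows "F v = (G v :: complex)"
proof -
  interpret F: bounded_linear F by fact
  interpret G: bounded_linear G by fact
  have span: "F w = G w" if "w \<in> complex_vector.span (e ` N)" for w
    using that
  proof (induction rule: complex_vector.span_induct_alt)
    case base
    show ?case by (simp add: F.zero G.zero)
  next
    case (step k x y)
    then show ?case by (auto simp: F.add G.add F G eq)
  qed
  have "closed {w. F w = G w}"
    by (intro closed_Collect_eq linear_continuous_on F.bounded_linear_axioms G.bounded_linear_axioms)
  then have "closure (complex_vector.span (e ` N)) \<subseteq> {w. F w = G w}"
    using span by (intro closure_minimal) auto
  then show ?thesis
    using assms(1) by (auto simp: orthonormal_basis_def)
qed

lemma orthonormal_basis_cinner_eqI:
  fixes e :: "'i \<Rightarrow> 'h::complex_hilbert"
  assumes e: "orthonormal_basis N e" and eq: "\<And>i. i \<in> N \<Longrightarrow> cinner (e i) u = cinner (e i) w"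
  shows "u = w"
proof -
  have eq': "cinner u (e i) = cinner w (e i)" if "i \<in> N" for i
    using eq[OF that] cinner_commute[of u "e i"] cinner_commute[of w "e i"] by simp
  have "cinner u v = cinner w v" for v
    by (rule orthonormal_basis_eqI[OF e bounded_linear_cinner bounded_linear_cinner])
      (use eq' in \<open>simp_all add: cinner_scaleC_right\<close>)
  then have "cinner v u = cinner v w" for v
    using cinner_commute[of v u] cinner_commute[of v w] by simp
  moreover have "cinner (u - w) u = cinner (u - w) (u - w) + cinner (u - w) w"
    using cinner_add_right[of "u - w" "u - w" w] by simp
  ultimately have "cinner (u - w) (u - w) = 0"
    by simp
  then show ?thesis
    by (simp add: cinner_self)
qed

section \<open>Bounded and compact operators\<close>

lemma bounded_opsD: "T \<in> bounded_ops \<Longrightarrow> blinfun_apply T (k *\<^sub>C v) = k *\<^sub>C blinfun_apply T v"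
  by (simp add: bounded_ops_def)

lemma compact_ops_subset: "compact_ops \<subseteq> bounded_ops"
  by (auto simp: compact_ops_def)

lemma id_blinfun_bounded_ops: "id_blinfun \<in> bounded_ops"
  by (simp add: bounded_ops_def)

lemma add_bounded_ops: "S \<in> bounded_ops \<Longrightarrow> T \<in> bounded_ops \<Longrightarrow> S + T \<in> bounded_ops"
  by (simp add: bounded_ops_def blinfun.add_left scaleC_add_right)

lemma scaleC_op_bounded_ops: "T \<in> bounded_ops \<Longrightarrow> scaleC_op k T \<in> bounded_ops"
  by (simp add: bounded_ops_def scaleC_op.rep_eq scaleC_scaleC mult.commute)

lemma compose_bounded_ops: "S \<in> bounded_ops \<Longrightarrow> T \<in> bounded_ops \<Longrightarrow> S o\<^sub>L T \<in> bounded_ops"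
  by (simp add: bounded_ops_def)

lemma rank_one_proj_bounded_ops: "rank_one_proj u \<in> bounded_ops"
  by (simp add: bounded_ops_def rank_one_proj.rep_eq cinner_scaleC_right scaleC_scaleC)

text \<open>Left multiplication by \<open>scaleC_op k id_blinfun\<close> carries facts about composition over to
  scalar multiples.\<close>

lemma scaleC_op_eq_compose: "scaleC_op k T = scaleC_op k id_blinfun o\<^sub>L T"
  by (rule blinfun_eqI) (simp add: scaleC_op.rep_eq)

lemma compose_scaleC_op: "S \<in> bounded_ops \<Longrightarrow> S o\<^sub>L scaleC_op k T = scaleC_op k (S o\<^sub>L T)"
  by (rule blinfun_eqI) (simp add: scaleC_op.rep_eq bounded_opsD)

lemma compact_opsI:
  assumes "T \<in> bounded_ops" "compact K" "blinfun_apply T ` cball 0 1 \<subseteq> K"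
  shows "T \<in> compact_ops"
proof -
  have "closure (blinfun_apply T ` cball 0 1) \<subseteq> K"
    using assms by (intro closure_minimal compact_imp_closed)
  then have "compact (K \<inter> closure (blinfun_apply T ` cball 0 1))"
    by (intro compact_Int_closed assms closed_closure)
  with \<open>closure _ \<subseteq> K\<close> show ?thesis
    using assms(1) by (simp add: compact_ops_def Int_absorb1)
qed

lemma rank_one_proj_compact_ops: "rank_one_proj u \<in> compact_ops"
proof (rule compact_opsI[OF rank_one_proj_bounded_ops])
  show "compact ((\<lambda>k. k *\<^sub>C u) ` cball 0 (norm u))"
    by (intro compact_continuous_image linear_continuous_on bounded_linear_scaleC_left compact_cball)
  have "cinner u v \<in> cball 0 (norm u)" if "v \<in> cball 0 1" for v
  proof -
    have "norm u * norm v \<le> norm u * 1"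
      using that by (intro mult_left_mono) auto
    with cinner_bound[of u v] show ?thesis by simp
  qed
  then show "blinfun_apply (rank_one_proj u) ` cball 0 1 \<subseteq> (\<lambda>k. k *\<^sub>C u) ` cball 0 (norm u)"
    by (auto simp: rank_one_proj.rep_eq)
qed

lemma compose_compact_ops:
  assumes S: "S \<in> bounded_ops" and T: "T \<in> compact_ops"
  shows "S o\<^sub>L T \<in> compact_ops"
proof (rule compact_opsI)
  show "S o\<^sub>L T \<in> bounded_ops"
    by (intro compose_bounded_ops compact_ops_subset[THEN subsetD] S T)
  show "compact (blinfun_apply S ` closure (blinfun_apply T ` cball 0 1))"
    using T by (intro compact_continuous_image linear_continuous_on blinfun.bounded_linear_right)
      (simp add: compact_ops_def)
  show "blinfun_apply (S o\<^sub>L T) ` cball 0 1 \<subseteq> blinfun_apply S ` closure (blinfun_apply T ` cball 0 1)"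
  proof (intro subsetI, elim imageE)
    fix u v assume "u = blinfun_apply (S o\<^sub>L T) v" "v \<in> cball 0 1"
    then have "u = blinfun_apply S (blinfun_apply T v)"
      "blinfun_apply T v \<in> closure (blinfun_apply T ` cball 0 1)"
      using closure_subset[of "blinfun_apply T ` cball 0 1"] by (simp, blast)
    then show "u \<in> blinfun_apply S ` closure (blinfun_apply T ` cball 0 1)"
      by (rule image_eqI)
  qed
qed

lemma add_compact_ops:
  assumes S: "S \<in> compact_ops" and T: "T \<in> compact_ops"
  shows "S + T \<in> compact_ops"
proof (rule compact_opsI)
  let ?C = "\<lambda>T. closure (blinfun_apply T ` cball 0 1)"
  show "S + T \<in> bounded_ops"
    by (intro add_bounded_ops compact_ops_subset[THEN subsetD] S T)
  show "compact {x + y |x y. x \<in> ?C S \<and> y \<in> ?C T}"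
    using assms by (intro compact_sums) (auto simp: compact_ops_def)
  show "blinfun_apply (S + T) ` cball 0 1 \<subseteq> {x + y |x y. x \<in> ?C S \<and> y \<in> ?C T}"
  proof (intro subsetI, elim imageE)
    fix u v assume u: "u = blinfun_apply (S + T) v" and v: "v \<in> cball 0 1"
    have "blinfun_apply S v \<in> ?C S" "blinfun_apply T v \<in> ?C T"
      using v by (auto intro!: closure_subset[THEN subsetD])
    with u show "u \<in> {x + y |x y. x \<in> ?C S \<and> y \<in> ?C T}"
      by (auto simp only: blinfun.add_left)
  qed
qed

lemma zero_compact_ops: "0 \<in> compact_ops"
proof (rule compact_opsI[of _ "{0}"])
  show "0 \<in> bounded_ops"
    by (simp add: bounded_ops_def complex_vector.scale_zero_right)
qed auto

lemma scaleC_op_compact_ops: "T \<in> compact_ops \<Longrightarrow> scaleC_op k T \<in> compact_ops"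
  by (subst scaleC_op_eq_compose)
    (intro compose_compact_ops scaleC_op_bounded_ops id_blinfun_bounded_ops)

section \<open>Closed right ideals of operator-valued functions\<close>

lemma cont_fun_memD: "x \<in> cont_fun X S \<Longrightarrow> s \<in> X \<Longrightarrow> x s \<in> S"
  by (auto simp: cont_fun_def)

lemma cont_fun_mono: "S \<subseteq> T \<Longrightarrow> cont_fun X S \<subseteq> cont_fun X T"
  by (auto simp: cont_fun_def)

lemma cont_fun_eqI: "x \<in> cont_fun X S \<Longrightarrow> (\<And>s. s \<in> X \<Longrightarrow> y s = x s) \<Longrightarrow> (\<lambda>s\<in>X. y s) = x"
  by (auto simp: cont_fun_def PiE_def extensional_def restrict_def)

lemma restrict_cont_fun:
  "continuous_on X x \<Longrightarrow> (\<And>s. s \<in> X \<Longrightarrow> x s \<in> S) \<Longrightarrow> (\<lambda>s\<in>X. x s) \<in> cont_fun X S"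
  by (auto simp: cont_fun_def cong: continuous_on_cong)

lemma continuous_on_blinfun_compose:
  "continuous_on X x \<Longrightarrow> continuous_on X y \<Longrightarrow> continuous_on X (\<lambda>s. x s o\<^sub>L y s)"
  by (rule bounded_bilinear.continuous_on[OF bounded_bilinear_blinfun_compose])

lemma fun_mult_cont_fun:
  assumes "x \<in> cont_fun X bounded_ops" "y \<in> cont_fun X compact_ops"
  shows "fun_mult X x y \<in> cont_fun X compact_ops"
  unfolding fun_mult_def using assms
  by (intro restrict_cont_fun continuous_on_blinfun_compose compose_compact_ops)
    (auto simp: cont_fun_def)

lemma fun_mult_assoc: "fun_mult X (fun_mult X x y) z = fun_mult X x (fun_mult X y z)"
  by (auto simp: fun_mult_def restrict_def intro!: blinfun_eqI)

lemma fun_mult_id_left: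
  "x \<in> cont_fun X S \<Longrightarrow> fun_mult X (\<lambda>s\<in>X. id_blinfun) x = x"
  unfolding fun_mult_def by (rule cont_fun_eqI) (auto intro: blinfun_eqI)

lemma fun_mult_add:
  "fun_mult X g (\<lambda>s\<in>X. x s + y s) = (\<lambda>s\<in>X. fun_mult X g x s + fun_mult X g y s)"
  by (auto simp: fun_mult_def restrict_def blinfun.add_left blinfun.add_right intro!: blinfun_eqI)

lemma fun_mult_scaleC_op:
  "(\<And>s. s \<in> X \<Longrightarrow> g s \<in> bounded_ops) \<Longrightarrow>
    fun_mult X g (\<lambda>s\<in>X. scaleC_op k (x s)) = (\<lambda>s\<in>X. scaleC_op k (fun_mult X g x s))"
  by (auto simp: fun_mult_def restrict_def compose_scaleC_op)

lemma fun_mult_zero: "fun_mult X g (\<lambda>s\<in>X. 0) = (\<lambda>s\<in>X. 0)"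
  by (auto simp: fun_mult_def restrict_def)

lemma uniform_limit_fun_mult:
  assumes bd: "bounded (g ` X)" and lim: "uniform_limit X xs x F"
  shows "uniform_limit X (\<lambda>n. fun_mult X g (xs n)) (fun_mult X g x) F"
proof -
  obtain K where K: "K > 0" "\<And>s. s \<in> X \<Longrightarrow> norm (g s) \<le> K"
    using bd by (auto simp: bounded_pos)
  show ?thesis
  proof (rule uniform_limitI)
    fix \<epsilon> :: real assume "\<epsilon> > 0"
    then have "\<forall>\<^sub>F n in F. \<forall>s\<in>X. dist (xs n s) (x s) < \<epsilon> / K"
      using lim K(1) by (intro uniform_limitD) auto
    then show "\<forall>\<^sub>F n in F. \<forall>s\<in>X. dist (fun_mult X g (xs n) s) (fun_mult X g x s) < \<epsilon>"
    proof eventually_elim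
      case (elim n)
      have "norm ((g s o\<^sub>L xs n s) - (g s o\<^sub>L x s)) < \<epsilon>" if s: "s \<in> X" for s
      proof -
        have "norm ((g s o\<^sub>L xs n s) - (g s o\<^sub>L x s)) = norm (g s o\<^sub>L (xs n s - x s))"
          by (rule arg_cong[where f = norm], rule blinfun_eqI) (simp add: blinfun.diff_left blinfun.diff_right)
        also have "\<dots> \<le> norm (g s) * norm (xs n s - x s)"
          by (rule norm_blinfun_compose)
        also have "\<dots> \<le> K * norm (xs n s - x s)"
          using K s by (intro mult_right_mono) auto
        also have "\<dots> < \<epsilon>"
          using elim s K(1) by (auto simp: dist_norm pos_less_divide_eq mult.commute)
        finally show ?thesis .
      qed
      then show ?case
        by (auto simp: fun_mult_def dist_norm)
    qed
  qed
qed

lemma closed_right_ideal_limitD: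
  assumes L: "closed_right_ideal X A L" and "\<And>n. xs n \<in> L" "x \<in> A" "uniform_limit X xs x sequentially"
  shows "x \<in> L"
proof -
  have "\<forall>xs x. (\<forall>n::nat. xs n \<in> L) \<longrightarrow> x \<in> A \<longrightarrow> uniform_limit X xs x sequentially \<longrightarrow> x \<in> L"
    using L unfolding closed_right_ideal_def by (elim conjE)
  from this[rule_format, OF assms(2-4)] show ?thesis .
qed

lemma closed_right_idealD:
  assumes L: "closed_right_ideal X A L"
  shows "L \<subseteq> A" "(\<lambda>s\<in>X. 0) \<in> L"
    "\<And>x y. x \<in> L \<Longrightarrow> y \<in> L \<Longrightarrow> (\<lambda>s\<in>X. x s + y s) \<in> L"
    "\<And>k x. x \<in> L \<Longrightarrow> (\<lambda>s\<in>X. scaleC_op k (x s)) \<in> L"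
    "\<And>x a. x \<in> L \<Longrightarrow> a \<in> A \<Longrightarrow> fun_mult X x a \<in> L"
proof -
  note D = L[unfolded closed_right_ideal_def]
  show "L \<subseteq> A" by (rule D[THEN conjunct1])
  show "(\<lambda>s\<in>X. 0) \<in> L" by (rule D[THEN conjunct2, THEN conjunct1])
  show "(\<lambda>s\<in>X. x s + y s) \<in> L" if "x \<in> L" "y \<in> L" for x y
    using that by (rule D[THEN conjunct2, THEN conjunct2, THEN conjunct1, rule_format])
  show "(\<lambda>s\<in>X. scaleC_op k (x s)) \<in> L" if "x \<in> L" for k x
    using that by (rule D[THEN conjunct2, THEN conjunct2, THEN conjunct2, THEN conjunct1, rule_format])
  show "fun_mult X x a \<in> L" if "x \<in> L" "a \<in> A" for x a
    using that by (rule D[THEN conjunct2, THEN conjunct2, THEN conjunct2, THEN conjunct2, THEN conjunct1,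
        rule_format])
qed

lemma closed_right_ideal_Int:
  assumes L: "closed_right_ideal X A L" and M: "closed_right_ideal X A M"
  shows "closed_right_ideal X A (L \<inter> M)"
  unfolding closed_right_ideal_def
proof (intro conjI allI ballI impI)
  fix xs :: "nat \<Rightarrow> _" and x
  assume "\<forall>n. xs n \<in> L \<inter> M" "x \<in> A" "uniform_limit X xs x sequentially"
  then show "x \<in> L \<inter> M"
    using closed_right_ideal_limitD[OF L, of xs x] closed_right_ideal_limitD[OF M, of xs x] by simp
qed (use closed_right_idealD[OF L] closed_right_idealD[OF M] in \<open>simp_all add: le_infI1\<close>)

lemma closed_right_ideal_cont_fun: "closed_right_ideal X (cont_fun X compact_ops) (cont_fun X compact_ops)"
  unfolding closed_right_ideal_def
proof (intro conjI allI ballI impI)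
  show "(\<lambda>s\<in>X. 0) \<in> cont_fun X compact_ops"
    by (intro restrict_cont_fun zero_compact_ops continuous_intros)
  fix x y :: "'a \<Rightarrow> 'b \<Rightarrow>\<^sub>L 'b"
  assume x: "x \<in> cont_fun X compact_ops" and y: "y \<in> cont_fun X compact_ops"
  then show "(\<lambda>s\<in>X. x s + y s) \<in> cont_fun X compact_ops"
    by (intro restrict_cont_fun add_compact_ops continuous_intros) (auto simp: cont_fun_def)
  show "fun_mult X x y \<in> cont_fun X compact_ops"
    using x y cont_fun_mono[OF compact_ops_subset] by (blast intro: fun_mult_cont_fun)
next
  fix k and x :: "'a \<Rightarrow> 'b \<Rightarrow>\<^sub>L 'b"
  assume x: "x \<in> cont_fun X compact_ops"
  have "continuous_on X (\<lambda>s. scaleC_op k id_blinfun o\<^sub>L x s)"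
    using x by (intro continuous_on_blinfun_compose continuous_intros) (auto simp: cont_fun_def)
  then show "(\<lambda>s\<in>X. scaleC_op k (x s)) \<in> cont_fun X compact_ops"
    using x by (intro restrict_cont_fun scaleC_op_compact_ops)
      (auto simp: cont_fun_def scaleC_op_eq_compose[symmetric])
qed auto

text \<open>Left multiplication by \<open>g\<close> commutes with all the right-module operations, so only closedness
  needs an argument of its own.  It is left as the hypothesis \<open>limits\<close>, because \<open>g x\<close> can fail to
  lie in \<open>A\<close> when \<open>g\<close> is discontinuous; then the closedness of \<open>L\<close> in \<open>A\<close> does not apply directly.\<close>

lemma closed_right_ideal_preimage:
  fixes X :: "'x::topological_space set"
  assumes g: "\<And>s. s \<in> X \<Longrightarrow> g s \<in> bounded_ops" and bd: "bounded (g ` X)"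
    and A: "A = cont_fun X compact_ops" and L: "closed_right_ideal X A L"
    and limits: "\<And>xs x. x \<in> A \<Longrightarrow> \<forall>n. fun_mult X g (xs n) \<in> L \<Longrightarrow>
      uniform_limit X (\<lambda>n. fun_mult X g (xs n)) (fun_mult X g x) sequentially \<Longrightarrow> fun_mult X g x \<in> L"
  shows "closed_right_ideal X A {x \<in> A. fun_mult X g x \<in> L}"
proof -
  have "closed_right_ideal X A A"
    by (simp add: A closed_right_ideal_cont_fun)
  note ideal = closed_right_idealD[OF this] closed_right_idealD[OF L]
  show ?thesis
    unfolding closed_right_ideal_def
  proof (intro conjI allI ballI impI)
    show "(\<lambda>s\<in>X. 0) \<in> {x \<in> A. fun_mult X g x \<in> L}"
      using ideal by (simp add: fun_mult_zero)
  next
    fix x y assume "x \<in> {x \<in> A. fun_mult X g x \<in> L}" "y \<in> {x \<in> A. fun_mult X g x \<in> L}"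
    then show "(\<lambda>s\<in>X. x s + y s) \<in> {x \<in> A. fun_mult X g x \<in> L}"
      using ideal by (simp add: fun_mult_add)
  next
    fix k x assume "x \<in> {x \<in> A. fun_mult X g x \<in> L}"
    then show "(\<lambda>s\<in>X. scaleC_op k (x s)) \<in> {x \<in> A. fun_mult X g x \<in> L}"
      using ideal by (simp add: fun_mult_scaleC_op[OF g])
  next
    fix x y assume "x \<in> {x \<in> A. fun_mult X g x \<in> L}" "y \<in> A"
    then show "fun_mult X x y \<in> {x \<in> A. fun_mult X g x \<in> L}"
      using ideal by (simp add: fun_mult_assoc[symmetric])
  next
    fix xs :: "nat \<Rightarrow> _" and x
    assume "\<forall>n. xs n \<in> {x \<in> A. fun_mult X g x \<in> L}" "x \<in> A" "uniform_limit X xs x sequentially"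
    then show "x \<in> {x \<in> A. fun_mult X g x \<in> L}"
      using limits[of x xs] uniform_limit_fun_mult[OF bd, of xs x sequentially] by simp
  qed auto
qed

text \<open>The multiplier \<open>g\<close> may be discontinuous: pointwise values of \<open>g x\<close> are automatically compact,
  so membership of \<open>g x\<close> in the algebra is a matter of continuity, and this survives uniform limits
  because \<open>g\<close> is bounded.\<close>

lemma closed_right_ideal_multiplier:
  fixes X :: "'x::topological_space set"
  assumes g: "\<And>s. s \<in> X \<Longrightarrow> g s \<in> bounded_ops" and bd: "bounded (g ` X)"
    and A: "A = cont_fun X compact_ops"
  shows "closed_right_ideal X A {x \<in> A. fun_mult X g x \<in> A}"
proof (rule closed_right_ideal_preimage[OF g bd A])
  show "closed_right_ideal X A A"
    by (simp add: A closed_right_ideal_cont_fun)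
  fix xs x
  assume x: "x \<in> A" and xs: "\<forall>n. fun_mult X g (xs n) \<in> A"
    and lim: "uniform_limit X (\<lambda>n. fun_mult X g (xs n)) (fun_mult X g x) sequentially"
  have "continuous_on X (fun_mult X g x)"
    by (rule uniform_limit_theorem[OF _ lim]) (use xs in \<open>auto simp: A cont_fun_def\<close>)
  moreover have "fun_mult X g x \<in> X \<rightarrow>\<^sub>E compact_ops"
    using g x by (auto simp: fun_mult_def A cont_fun_def intro!: compose_compact_ops)
  ultimately show "fun_mult X g x \<in> A"
    by (simp add: A cont_fun_def)
qed

lemma fun_inverse_eqI:
  assumes d: "is_fun_inverse X c d"
  shows "fun_inverse X c = d"
  unfolding fun_inverse_def
proof (rule the_equality)
  show "is_fun_inverse X c d" by (rule d)
next
  fix d' assume d': "is_fun_inverse X c d'"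
  have "d' = fun_mult X (\<lambda>s\<in>X. id_blinfun) d'"
    by (rule fun_mult_id_left[symmetric, where S = bounded_ops]) (use d' in \<open>simp add: is_fun_inverse_def\<close>)
  also have "\<dots> = fun_mult X (fun_mult X d c) d'"
    using d by (simp only: is_fun_inverse_def)
  also have "\<dots> = fun_mult X d (\<lambda>s\<in>X. id_blinfun)"
    unfolding fun_mult_assoc using d' by (simp only: is_fun_inverse_def)
  also have "\<dots> = d"
    unfolding fun_mult_def by (rule cont_fun_eqI[where S = bounded_ops])
      (use d in \<open>auto simp: is_fun_inverse_def intro: blinfun_eqI\<close>)
  finally show "d' = d" .
qed

text \<open>The image under the inverse is the preimage under \<open>c\<close>, so the preimage lemma above also
  covers ideals of the form \<open>c\<^sup>-\<^sup>1 L\<close>.\<close>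

lemma inverse_image_iff:
  assumes d: "is_fun_inverse X c d" and A: "A = cont_fun X compact_ops" and L: "L \<subseteq> A"
  shows "x \<in> fun_mult X d ` L \<longleftrightarrow> x \<in> A \<and> fun_mult X c x \<in> L"
proof -
  have cd: "fun_mult X c (fun_mult X d y) = y" "fun_mult X d (fun_mult X c y) = y" if "y \<in> A" for y
  proof -
    have "fun_mult X (\<lambda>s\<in>X. id_blinfun) y = y"
      using that unfolding A by (rule fun_mult_id_left)
    then show "fun_mult X c (fun_mult X d y) = y" "fun_mult X d (fun_mult X c y) = y"
      using d unfolding fun_mult_assoc[symmetric] by (simp_all only: is_fun_inverse_def)
  qed
  show ?thesis
  proof
    assume "x \<in> fun_mult X d ` L"
    then obtain y where y: "x = fun_mult X d y" "y \<in> L" "y \<in> A"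
      using L by blast
    have "d \<in> cont_fun X bounded_ops"
      using d by (simp add: is_fun_inverse_def)
    then have "x \<in> A"
      using y(3) unfolding y(1) A by (rule fun_mult_cont_fun)
    moreover have "fun_mult X c x = y"
      unfolding y(1) by (rule cd(1)[OF y(3)])
    ultimately show "x \<in> A \<and> fun_mult X c x \<in> L"
      using y(2) by simp
  next
    assume x: "x \<in> A \<and> fun_mult X c x \<in> L"
    show "x \<in> fun_mult X d ` L"
      by (rule image_eqI[where x = "fun_mult X c x"]) (use x cd(2) in auto)
  qed
qed

lemma closed_right_ideal_inverse_image:
  fixes X :: "'x::topological_space set"
  assumes X: "compact X" and d: "is_fun_inverse X c d" and A: "A = cont_fun X compact_ops"
    and L: "closed_right_ideal X A L"
  shows "closed_right_ideal X A (fun_mult X d ` L)"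
proof -
  have c: "c \<in> cont_fun X bounded_ops"
    using d by (simp add: is_fun_inverse_def)
  have "closed_right_ideal X A {x \<in> A. fun_mult X c x \<in> L}"
  proof (rule closed_right_ideal_preimage[OF _ _ A L])
    show "c s \<in> bounded_ops" if "s \<in> X" for s
      using c that by (rule cont_fun_memD)
    show "bounded (c ` X)"
      using c X by (intro compact_imp_bounded compact_continuous_image) (auto simp: cont_fun_def)
    fix xs x
    assume x: "x \<in> A" and xs: "\<forall>n. fun_mult X c (xs n) \<in> L"
      and lim: "uniform_limit X (\<lambda>n. fun_mult X c (xs n)) (fun_mult X c x) sequentially"
    have "fun_mult X c x \<in> A"
      using c x by (simp add: A fun_mult_cont_fun)
    with xs lim show "fun_mult X c x \<in> L"
      using closed_right_ideal_limitD[OF L, where xs = "\<lambda>n. fun_mult X c (xs n)"] by simp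
  qed
  moreover have "fun_mult X d ` L = {x \<in> A. fun_mult X c x \<in> L}"
  proof -
    have "L \<subseteq> A"
      using L by (rule closed_right_idealD)
    then show ?thesis
      by (intro set_eqI) (simp only: inverse_image_iff[OF d A] mem_Collect_eq)
  qed
  ultimately show ?thesis by simp
qed

section \<open>Weighted sums of the basis projections\<close>

lemma norm_rank_one_proj_le: "norm (rank_one_proj u) \<le> norm u * norm u"
proof (rule norm_blinfun_bound)
  show "norm (blinfun_apply (rank_one_proj u) v) \<le> norm u * norm u * norm v" for v
    using mult_right_mono[OF cinner_bound[of u v], of "norm u"]
    by (simp add: rank_one_proj.rep_eq norm_scaleC mult_ac)
qed simp

lemma orthonormal_basis_norm:
  assumes "orthonormal_basis N e" "i \<in> N"
  shows "norm (e i) = 1"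
proof -
  have "complex_of_real ((norm (e i))\<^sup>2) = complex_of_real 1"
    using assms unfolding orthonormal_basis_def cinner_self[symmetric] by auto
  then have "(norm (e i))\<^sup>2 = 1"
    using of_real_eq_iff by blast
  then show ?thesis
    by (simp add: power2_eq_1_iff) (metis norm_ge_zero not_one_le_zero neg_0_le_iff_le order_trans zero_le_one)
qed

context
  fixes N :: "'i set" and e :: "'i \<Rightarrow> 'h::complex_hilbert" and w r :: "'i \<Rightarrow> real"
  assumes e: "orthonormal_basis N e" and w: "w summable_on N" and r: "\<And>i. i \<in> N \<Longrightarrow> \<bar>r i\<bar> \<le> w i"
begin

lemma abs_summable_on_projections: "(\<lambda>i. r i *\<^sub>R rank_one_proj (e i)) abs_summable_on N"
  and norm_projections_le: "\<And>i. i \<in> N \<Longrightarrow> norm (r i *\<^sub>R rank_one_proj (e i)) \<le> w i"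
proof -
  show le: "norm (r i *\<^sub>R rank_one_proj (e i)) \<le> w i" if "i \<in> N" for i
  proof -
    have "\<bar>r i\<bar> * norm (rank_one_proj (e i)) \<le> w i * 1"
      using r[OF that] norm_rank_one_proj_le[of "e i"] orthonormal_basis_norm[OF e that]
      by (intro mult_mono) auto
    then show ?thesis by simp
  qed
  show "(\<lambda>i. r i *\<^sub>R rank_one_proj (e i)) abs_summable_on N"
    using w le by (rule summable_on_comparison_test) auto
qed

lemma norm_infsum_projections: "norm (\<Sum>\<^sub>\<infinity>i\<in>N. r i *\<^sub>R rank_one_proj (e i)) \<le> (\<Sum>\<^sub>\<infinity>i\<in>N. w i)"
  by (rule order_trans[OF norm_infsum_bound[OF abs_summable_on_projections] infsum_mono])
    (use abs_summable_on_projections w norm_projections_le in auto)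

text \<open>The functional \<open>F\<close> is kept general because it is taken to be the identity and scalar
  multiplication (for complex linearity) as well as \<open>cinner (e j)\<close> (for the rows).\<close>

lemma infsum_projections_apply:
  assumes F: "bounded_linear F"
  shows "F (blinfun_apply (\<Sum>\<^sub>\<infinity>i\<in>N. r i *\<^sub>R rank_one_proj (e i)) v)
    = (\<Sum>\<^sub>\<infinity>i\<in>N. F (r i *\<^sub>R cinner (e i) v *\<^sub>C e i))"
proof -
  have "bounded_linear (\<lambda>T. F (blinfun_apply T v))"
    by (rule bounded_linear_compose[OF F blinfun.bounded_linear_left])
  from infsumI[OF has_sum_bounded_linear[OF this has_sum_infsum[OF abs_summable_summable[OF abs_summable_on_projections]]]]
  show ?thesis
    by (simp add: blinfun.scaleR_left rank_one_proj.rep_eq)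
qed

lemma infsum_projections_bounded_ops: "(\<Sum>\<^sub>\<infinity>i\<in>N. r i *\<^sub>R rank_one_proj (e i)) \<in> bounded_ops"
  unfolding bounded_ops_def
  using infsum_projections_apply[OF bounded_linear_ident] infsum_projections_apply[OF bounded_linear_scaleC]
  by (simp add: cinner_scaleC_right scaleR_scaleC scaleC_scaleC mult_ac)

lemma cinner_infsum_projections:
  assumes j: "j \<in> N"
  shows "cinner (e j) (blinfun_apply (\<Sum>\<^sub>\<infinity>i\<in>N. r i *\<^sub>R rank_one_proj (e i)) v)
    = of_real (r j) * cinner (e j) v"
proof -
  let ?g = "\<lambda>i. of_real (r i) * (cinner (e i) v * cinner (e j) (e i))"
  have "cinner (e j) (blinfun_apply (\<Sum>\<^sub>\<infinity>i\<in>N. r i *\<^sub>R rank_one_proj (e i)) v) = (\<Sum>\<^sub>\<infinity>i\<in>N. ?g i)"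
    by (subst infsum_projections_apply[OF bounded_linear_cinner])
      (simp add: scaleR_scaleC cinner_scaleC_right mult.assoc)
  also have "\<dots> = (\<Sum>\<^sub>\<infinity>i\<in>{j}. ?g i)"
    using e j by (intro infsum_cong_neutral) (auto simp: orthonormal_basis_def)
  also have "\<dots> = of_real (r j) * cinner (e j) v"
    using e j by (simp add: orthonormal_basis_def)
  finally show ?thesis .
qed

end

section \<open>Zeros forced by continuity\<close>

text \<open>A continuous function that has been cut off after \<open>\<tau>\<close> has the limit \<open>0\<close> at \<open>\<tau>\<close> from the
  right; this needs room to the right of \<open>\<tau>\<close>.\<close>

lemma vanishes_at_cutoff:
  fixes h :: "real \<Rightarrow> 'a::real_normed_vector"
  assumes "continuous_on {a..b} h" "\<And>s. s \<in> {a..b} \<Longrightarrow> s > \<tau> \<Longrightarrow> h s = 0" "a \<le> \<tau>" "\<tau> < b"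
  shows "h \<tau> = 0"
proof (rule continuous_constant_on_closure[where f = h and S = "{\<tau><..b}"])
  show "continuous_on (closure {\<tau><..b}) h"
    using assms by (auto intro: continuous_on_subset)
  show "h s = 0" if "s \<in> {\<tau><..b}" for s
    using assms that by auto
  show "\<tau> \<in> closure {\<tau><..b}"
    using assms by simp
qed

text \<open>The end point \<open>1\<close> has to be left out of the dense set, as the cut-off at \<open>1\<close> is not a jump.\<close>

lemma zero_on_unit_interval:
  fixes h :: "real \<Rightarrow> 'a::real_normed_vector"
  assumes h: "continuous_on {0..1} h" and D: "D \<subseteq> {0..1}" "{0..1} \<subseteq> closure D"
    and zero: "\<And>s. s \<in> D \<Longrightarrow> s < 1 \<Longrightarrow> h s = 0" and s: "s \<in> {0..1}"
  shows "h s = 0"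
proof -
  let ?D = "{..<1} \<inter> D"
  have "closure ?D \<subseteq> {0..1}"
    using D by (intro closure_minimal) auto
  then have "continuous_on (closure ?D) h"
    using h continuous_on_subset by blast
  moreover have "h s = 0" if "s \<in> ?D" for s
    using zero that by auto
  moreover have "s \<in> closure ?D"
  proof -
    have "{0..<1} \<subseteq> {..<1} \<inter> closure D"
      using D(2) by auto
    also have "\<dots> \<subseteq> closure ?D"
      by (rule open_Int_closure_subset) simp
    finally have "closure {0..<1::real} \<subseteq> closure ?D"
      by (intro closure_minimal) auto
    then show ?thesis
      using s by auto
  qed
  ultimately show ?thesis
    by (rule continuous_constant_on_closure)
qed

theorem lemma3p1:
  fixes e :: "nat \<Rightarrow> 'h::complex_hilbert"
    and X :: "real set"
    and t :: "nat \<Rightarrow> real"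
    and \<eta> :: "nat \<Rightarrow> complex"
    and b :: "'h \<Rightarrow>\<^sub>L 'h"
    and f c :: "real \<Rightarrow> ('h \<Rightarrow>\<^sub>L 'h)"
    and A J I :: "(real \<Rightarrow> ('h \<Rightarrow>\<^sub>L 'h)) set"
  assumes e_basis: "orthonormal_basis {1..} e"
    and X_def: "X = {0..1}"
    and A_def: "A = cont_fun X compact_ops"
    and t_in: "t ` {1..} \<subseteq> X"
    and t_dense: "X \<subseteq> closure (t ` {1..})"
    and f_def: "f = (\<lambda>s\<in>X. \<Sum>\<^sub>\<infinity>i\<in>{1..}. ((1 / 2 ^ i) * indicator {0..t i} s) *\<^sub>R rank_one_proj (e i))"
    and J_def: "J = {x \<in> A. fun_mult X f x \<in> A}"
    and \<eta>_nonzero: "\<forall>i\<ge>1. \<eta> i \<noteq> 0"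
    and \<eta>_summable: "(\<lambda>i. (cmod (\<eta> i))\<^sup>2) summable_on {1..}"
    and \<eta>_small: "(\<Sum>\<^sub>\<infinity>i\<in>{1..}. (cmod (\<eta> i))\<^sup>2) < 1 / 2"
    and b_compact: "b \<in> compact_ops"
    and b_matrix: "\<forall>i\<ge>1. \<forall>j\<ge>1. op_matrix e b i j = (if j = 1 then \<eta> i else 0)"
    and c_def: "c = (\<lambda>s\<in>X. b + id_blinfun)"
    and I_def: "I = fun_mult X (fun_inverse X c) ` J"
  shows "(\<exists>d. is_fun_inverse X c d) \<and>
         closed_right_ideal X A I \<and>
         closed_right_ideal X A (I \<inter> J) \<and>
         \<not> thick X A (I \<inter> J)"
proof -
  let ?p = "\<lambda>i. rank_one_proj (e i)"
  let ?r = "\<lambda>s i. (1 / 2 ^ i) * indicator {0..t i} s :: real"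
  have e_cinner: "cinner (e i) (e j) = (if i = j then 1 else 0)" if "i \<ge> 1" "j \<ge> 1" for i j
    using e_basis that by (auto simp: orthonormal_basis_def)
  have "(\<lambda>i. (1 / 2) ^ i :: real) summable_on UNIV"
    by (subst summable_on_UNIV_nonneg_real_iff) (auto intro: summable_geometric)
  then have w: "(\<lambda>i. 1 / 2 ^ i :: real) summable_on {1..}"
    by (auto simp: power_one_over intro: summable_on_subset_banach)
  have r: "\<bar>?r s i\<bar> \<le> 1 / 2 ^ i" for s i
    by (simp add: indicator_def)

  have f_bounded_ops: "f s \<in> bounded_ops" if "s \<in> X" for s
    using infsum_projections_bounded_ops[OF e_basis w r] that by (simp add: f_def)
  have "norm (f s) \<le> (\<Sum>\<^sub>\<infinity>i\<in>{1..}. 1 / 2 ^ i)" if "s \<in> X" for s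
    using norm_infsum_projections[OF e_basis w r] that by (simp add: f_def)
  then have "bounded (f ` X)"
    unfolding bounded_iff by blast
  then have J_ideal: "closed_right_ideal X A J"
    unfolding J_def using f_bounded_ops A_def by (intro closed_right_ideal_multiplier) auto
  then have J_sub: "J \<subseteq> A"
    by (rule closed_right_idealD)

  have row_cont: "continuous_on X (\<lambda>s. cinner u (blinfun_apply (x s) v))" if "x \<in> A" for x u v
    using that unfolding A_def cont_fun_def
    by (intro bounded_linear.continuous_on[OF bounded_linear_cinner]
        bounded_linear.continuous_on[OF blinfun.bounded_linear_left]) auto
  \<comment> \<open>Continuity of \<open>f x\<close> across the jump of \<open>f\<close> at \<open>t i\<close> forces a zero of the \<open>i\<close>-th row of \<open>x\<close>.\<close>
  have J_row: "cinner (e i) (blinfun_apply (x (t i)) v) = 0"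
    if x: "x \<in> J" and i: "i \<ge> 1" "t i < 1" for x i v
  proof -
    let ?h = "\<lambda>s. cinner (e i) (blinfun_apply (fun_mult X f x s) v)"
    have h: "?h s = of_real (?r s i) * cinner (e i) (blinfun_apply (x s) v)" if "s \<in> X" for s
      unfolding fun_mult_def f_def using cinner_infsum_projections[OF e_basis w r] that i by simp
    have ti: "t i \<in> X"
      using t_in i by auto
    have "?h (t i) = 0"
    proof (rule vanishes_at_cutoff)
      show "continuous_on {0..1} ?h"
        using row_cont[of "fun_mult X f x"] x by (simp add: J_def X_def)
      show "?h s = 0" if "s \<in> {0..1}" "t i < s" for s
        using h[of s] that by (simp add: X_def)
    qed (use ti i X_def in auto)
    then show ?thesis
      using h[OF ti] ti by (simp add: X_def)
  qed

  have b: "b \<in> bounded_ops"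
    using b_compact compact_ops_subset by blast
  have b_row: "cinner (e i) (blinfun_apply b v) = \<eta> i * cinner (e 1) v" if i: "i \<ge> 1" for i v
  proof (rule orthonormal_basis_eqI[OF e_basis])
    show "bounded_linear (\<lambda>v. cinner (e i) (blinfun_apply b v))"
      by (rule bounded_linear_compose[OF bounded_linear_cinner blinfun.bounded_linear_right])
    show "bounded_linear (\<lambda>v. \<eta> i * cinner (e 1) v)"
      by (rule bounded_linear_compose[OF bounded_linear_mult_right bounded_linear_cinner])
    show "cinner (e i) (blinfun_apply b (e j)) = \<eta> i * cinner (e 1) (e j)" if "j \<in> {1..}" for j
      using b_matrix that i by (auto simp: e_cinner op_matrix_def)
  qed (simp_all add: bounded_opsD[OF b] cinner_scaleC_right)
  have b_square: "b o\<^sub>L b = scaleC_op (\<eta> 1) b"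
    by (intro blinfun_eqI orthonormal_basis_cinner_eqI[OF e_basis])
      (simp add: b_row scaleC_op.rep_eq cinner_scaleC_right)

  have "(cmod (\<eta> 1))\<^sup>2 = (\<Sum>\<^sub>\<infinity>i\<in>{1}. (cmod (\<eta> i))\<^sup>2)"
    by simp
  also have "\<dots> \<le> (\<Sum>\<^sub>\<infinity>i\<in>{1..}. (cmod (\<eta> i))\<^sup>2)"
    by (rule infsum_mono_neutral) (use \<eta>_summable in auto)
  finally have "(cmod (\<eta> 1))\<^sup>2 \<noteq> 1"
    using \<eta>_small by linarith
  then have \<eta>1: "1 + \<eta> 1 \<noteq> 0"
    by (metis add_eq_0_iff norm_minus_cancel norm_one one_power2)
  \<comment> \<open>As \<open>b\<^sup>2 = \<eta>\<^sub>1 b\<close>, the product \<open>(1 + b) (1 + k b)\<close> equals \<open>1 + (k + 1 + k \<eta>\<^sub>1) b\<close>; the number \<open>k\<close> is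
    chosen to make the coefficient of \<open>b\<close> zero.\<close>
  define k where "k = - 1 / (1 + \<eta> 1)"
  have k: "k + 1 + k * \<eta> 1 = 0"
    using \<eta>1 by (simp add: k_def field_simps)
  define d where "d = (\<lambda>s\<in>X. scaleC_op k b + id_blinfun)"
  have cancel: "scaleC_op k (b o\<^sub>L b) + scaleC_op k b + b = 0"
  proof (rule blinfun_eqI)
    fix v
    have "blinfun_apply (scaleC_op k (b o\<^sub>L b) + scaleC_op k b + b) v
      = (k * \<eta> 1) *\<^sub>C blinfun_apply b v + k *\<^sub>C blinfun_apply b v + 1 *\<^sub>C blinfun_apply b v"
      unfolding b_square by (simp add: blinfun.add_left scaleC_op.rep_eq scaleC_scaleC scaleC_one)
    also have "\<dots> = (k + 1 + k * \<eta> 1) *\<^sub>C blinfun_apply b v"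
      by (simp only: scaleC_add_left ac_simps)
    also have "\<dots> = blinfun_apply 0 v"
      by (simp only: k complex_vector.scale_zero_left blinfun.zero_left)
    finally show "blinfun_apply (scaleC_op k (b o\<^sub>L b) + scaleC_op k b + b) v = blinfun_apply 0 v" .
  qed
  have "(b + id_blinfun) o\<^sub>L (scaleC_op k b + id_blinfun) = scaleC_op k (b o\<^sub>L b) + scaleC_op k b + b + id_blinfun"
    "(scaleC_op k b + id_blinfun) o\<^sub>L (b + id_blinfun) = scaleC_op k (b o\<^sub>L b) + scaleC_op k b + b + id_blinfun"
    by (intro blinfun_eqI; simp add: blinfun.add_left blinfun.add_right scaleC_op.rep_eq
        scaleC_add_right bounded_opsD[OF b])+
  then have inv: "is_fun_inverse X c d"
    unfolding is_fun_inverse_def c_def d_def cancel using b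
    by (auto simp: fun_mult_def cancel intro!: restrict_cont_fun add_bounded_ops scaleC_op_bounded_ops
        id_blinfun_bounded_ops)
  have I_eq: "I = fun_mult X d ` J"
    by (simp add: I_def fun_inverse_eqI[OF inv])
  have I_ideal: "closed_right_ideal X A I"
    unfolding I_eq by (rule closed_right_ideal_inverse_image[OF _ inv A_def J_ideal]) (simp add: X_def)

  \<comment> \<open>At \<open>t i < 1\<close> the \<open>i\<close>-th rows of \<open>x\<close> and of \<open>c x\<close> both vanish, so the \<open>i\<close>-th row of their
    difference \<open>b x\<close>, which is \<open>\<eta> i\<close> times the first row of \<open>x\<close>, vanishes there too.\<close>
  have first_row: "cinner (e 1) (blinfun_apply (x s) v) = 0" if x: "x \<in> I" "x \<in> J" and s: "s \<in> X" for x s v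
  proof -
    let ?h = "\<lambda>s. cinner (e 1) (blinfun_apply (x s) v)"
    have cx: "fun_mult X c x \<in> J"
      using x(1) inverse_image_iff[OF inv A_def J_sub] by (simp add: I_eq)
    have "?h (t i) = 0" if i: "i \<ge> 1" "t i < 1" for i
    proof -
      have "t i \<in> X"
        using t_in i by auto
      then have "cinner (e i) (blinfun_apply (fun_mult X c x (t i)) v)
        = \<eta> i * ?h (t i) + cinner (e i) (blinfun_apply (x (t i)) v)"
        using i by (simp add: fun_mult_def c_def blinfun.add_left cinner_add_right b_row)
      then show ?thesis
        using J_row[OF cx i] J_row[OF x(2) i] \<eta>_nonzero i by simp
    qed
    moreover have "continuous_on X ?h"
      using row_cont x(2) J_sub by blast
    ultimately show ?thesis
      using zero_on_unit_interval[of ?h "t ` {1..}" s] t_in t_dense s unfolding X_def by auto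
  qed

  let ?a = "\<lambda>s\<in>X. ?p 1"
  have "?a \<in> A"
    unfolding A_def by (intro restrict_cont_fun rank_one_proj_compact_ops continuous_intros)
  moreover have "fun_mult X ?a x = (\<lambda>s\<in>X. 0)" if "x \<in> I \<inter> J" for x
  proof -
    have "?p 1 o\<^sub>L x s = 0" if "s \<in> X" for s
      using first_row[of x s] \<open>x \<in> I \<inter> J\<close> that by (intro blinfun_eqI) (simp add: rank_one_proj.rep_eq)
    then show ?thesis
      by (auto simp: fun_mult_def restrict_def)
  qed
  moreover have "?a \<noteq> (\<lambda>s\<in>X. 0)"
  proof
    assume "?a = (\<lambda>s\<in>X. 0)"
    then have "?p 1 = 0"
      by (metis X_def atLeastAtMost_iff order_refl restrict_apply' zero_le_one)
    then have "blinfun_apply (?p 1) (e 1) = 0"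
      by simp
    then have "e 1 = 0"
      by (simp add: rank_one_proj.rep_eq e_cinner scaleC_one)
    then show False
      using orthonormal_basis_norm[OF e_basis, of 1] by simp
  qed
  ultimately have "\<not> thick X A (I \<inter> J)"
    unfolding thick_def by blast
  then show ?thesis
    using inv I_ideal closed_right_ideal_Int[OF I_ideal J_ideal] by blast
qed

end
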